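(* For every integer $n\ge 1$, with $$\rho_n = \left\lfloor \frac{-3 + \sqrt{8n+17}}{2} \right\rfloor, \qquad \lambda_n = n + 2 - T_{\rho_n+1}, \qquad T_i=\binom{i+1}{2},$$ we have $$|\mathcal{Z}_{n+1}(3\underline{21})| = |\mathcal{Y}_{n+1}(1\underline{23})| = |\mathcal{Y}_{n+1}(\underline{12}3)| = \binom{\rho_n}{\lambda_n}+\binom{\rho_n+1}{\lambda_n-1}$$ and $$\operatorname{maxinv} \mathcal{S}_{n+1}(3\underline{21})= \binom{n-\rho_n +1}{2} + \binom{\rho_n + 2}{3},$$ while $$\operatorname{mininv} \mathcal{S}_{n+1}(1\underline{23}) = \operatorname{mininv} \mathcal{S}_{n+1}(\underline{12}3) = \binom{n+1}{2} - \binom{\rho_n + 2}{3} - \binom{n-\rho_n +1}{2}.$$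
   Context: $\mathcal{S}_N$ is the set of permutations $\pi=\pi_1\cdots\pi_N$ of $\{1,\dots,N\}$, and $\operatorname{inv}(\pi) = |\{(i,j) : i<j,\ \pi_i>\pi_j\}|$. For a vincular pattern $\sigma$ (underlined letters must be matched by adjacent entries), $\mathcal{S}_N(\sigma)$ is the set of $\pi\in\mathcal{S}_N$ avoiding $\sigma$. Explicitly: $\pi$ avoids $3\underline{21}$ if there are no $1\le i<j<j+1\le N$ with $\pi_i>\pi_j>\pi_{j+1}$; $\pi$ avoids $1\underline{23}$ if there are no $1\le i<j<j+1\le N$ with $\pi_i<\pi_j<\pi_{j+1}$; $\pi$ avoids $\underline{12}3$ if there are no $1\le i<i+1<j\le N$ with $\pi_i<\pi_{i+1}<\pi_j$. $\operatorname{maxinv}\mathcal{S}_N(\sigma)$ and $\operatorname{mininv}\mathcal{S}_N(\sigma)$ are the maximum and minimum of $\operatorname{inv}$ over $\mathcal{S}_N(\sigma)$; $\mathcal{Z}_N(\sigma)$ and $\mathcal{Y}_N(\sigma)$ are the subsets of $\mathcal{S}_N(\sigma)$ of permutations achieving the maximum and the minimum, respectively. Convention: $\binom{a}{b}=0$ if $b<0$ or $b>a$ (for integers $a\ge 0$). *)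

theory Defs
  imports Complex_Main "HOL-Combinatorics.Permutations"
begin

text \<open>
  The word \<open>\<pi>\<^sub>1\<dots>\<pi>\<^sub>N\<close> is encoded as a function \<open>\<pi> :: nat \<Rightarrow> nat\<close> with \<open>\<pi> i = \<pi>\<^sub>i\<close>.
  Since \<open>permutes\<close> forces \<open>\<pi>\<close> to be the identity outside \<open>{1..N}\<close>, distinct elements of
  \<open>Sym N\<close> are distinct words.
\<close>

definition Sym :: "nat \<Rightarrow> (nat \<Rightarrow> nat) set" where
  "Sym N = {\<pi>. \<pi> permutes {1..N}}"

definition inversions :: "nat \<Rightarrow> (nat \<Rightarrow> nat) \<Rightarrow> nat" where
  "inversions N \<pi> = card {(i, j). 1 \<le> i \<and> i < j \<and> j \<le> N \<and> \<pi> i > \<pi> j}"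

text \<open>
  An underscore in a constant name separates the letter of the vincular pattern that is
  unconstrained from the two underlined letters, which must be matched by adjacent entries.
\<close>

definition avoids_3_21 :: "nat \<Rightarrow> (nat \<Rightarrow> nat) \<Rightarrow> bool" where
  "avoids_3_21 N \<pi> \<longleftrightarrow>
     \<not> (\<exists>i j. 1 \<le> i \<and> i < j \<and> j + 1 \<le> N \<and> \<pi> i > \<pi> j \<and> \<pi> j > \<pi> (j + 1))"

definition avoids_1_23 :: "nat \<Rightarrow> (nat \<Rightarrow> nat) \<Rightarrow> bool" where
  "avoids_1_23 N \<pi> \<longleftrightarrow>
     \<not> (\<exists>i j. 1 \<le> i \<and> i < j \<and> j + 1 \<le> N \<and> \<pi> i < \<pi> j \<and> \<pi> j < \<pi> (j + 1))"

definition avoids_12_3 :: "nat \<Rightarrow> (nat \<Rightarrow> nat) \<Rightarrow> bool" where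
  "avoids_12_3 N \<pi> \<longleftrightarrow>
     \<not> (\<exists>i j. 1 \<le> i \<and> i + 1 < j \<and> j \<le> N \<and> \<pi> i < \<pi> (i + 1) \<and> \<pi> (i + 1) < \<pi> j)"

text \<open>
  In the following definitions \<open>av\<close> is one of the three avoidance predicates.
\<close>

definition Sym_av :: "nat \<Rightarrow> (nat \<Rightarrow> (nat \<Rightarrow> nat) \<Rightarrow> bool) \<Rightarrow> (nat \<Rightarrow> nat) set" where
  "Sym_av N av = {\<pi> \<in> Sym N. av N \<pi>}"

definition maxinv :: "nat \<Rightarrow> (nat \<Rightarrow> (nat \<Rightarrow> nat) \<Rightarrow> bool) \<Rightarrow> nat" where
  "maxinv N av = Max (inversions N ` Sym_av N av)"

definition mininv :: "nat \<Rightarrow> (nat \<Rightarrow> (nat \<Rightarrow> nat) \<Rightarrow> bool) \<Rightarrow> nat" where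
  "mininv N av = Min (inversions N ` Sym_av N av)"

definition Zset :: "nat \<Rightarrow> (nat \<Rightarrow> (nat \<Rightarrow> nat) \<Rightarrow> bool) \<Rightarrow> (nat \<Rightarrow> nat) set" where
  "Zset N av = {\<pi> \<in> Sym_av N av. inversions N \<pi> = maxinv N av}"

definition Yset :: "nat \<Rightarrow> (nat \<Rightarrow> (nat \<Rightarrow> nat) \<Rightarrow> bool) \<Rightarrow> (nat \<Rightarrow> nat) set" where
  "Yset N av = {\<pi> \<in> Sym_av N av. inversions N \<pi> = mininv N av}"

text \<open>
  Binomial coefficients with integer arguments, vanishing unless \<open>0 \<le> b \<le> a\<close>.
  The lower argument \<open>lam n - 1\<close> is \<open>-1\<close> whenever \<open>n + 2\<close> is a triangular number, so
  truncated subtraction on \<open>nat\<close> would give the wrong value.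
\<close>

definition ibinom :: "int \<Rightarrow> int \<Rightarrow> int" where
  "ibinom a b = (if 0 \<le> b \<and> b \<le> a then int (nat a choose nat b) else 0)"

definition tri :: "int \<Rightarrow> int" where
  "tri i = ibinom (i + 1) 2"

definition rho :: "nat \<Rightarrow> int" where
  "rho n = \<lfloor>(- 3 + sqrt (8 * real n + 17)) / 2\<rfloor>"

definition lam :: "nat \<Rightarrow> int" where
  "lam n = int n + 2 - tri (rho n + 1)"

end

theory Submission
  imports Defs
begin

text \<open>
  If \<open>m\<close> is the maximum of a word avoiding \<open>12\<close>-\<open>3\<close> (the first two letters adjacent), the entries
  before \<open>m\<close> must decrease, and there is no further condition beyond the avoidance by the entries
  after \<open>m\<close>. So a word \<open>as @ m # ys\<close> with \<open>t\<close> entries before \<open>m\<close> has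
  \<open>C(t, 2) + |ys| + inv ys + cross\<close> inversions, where \<open>cross\<close> counts those between \<open>as\<close> and \<open>ys\<close>.
  For every slope \<open>d\<close> there is a tangent bound \<open>inv xs \<ge> d |xs| - K d\<close>, with
  \<open>K (d + 1) - K d = (d + 1) (d + 4) / 2\<close>: the slack of \<open>xs\<close> at slope \<open>d + 1\<close> is the slack of
  \<open>ys\<close> at slope \<open>d\<close>, plus \<open>cross\<close>, plus \<open>(t - d - 1) (t - d - 2) / 2\<close>, and all three are
  nonnegative. Hence equality forces \<open>as\<close> to consist of the \<open>t\<close> smallest letters with
  \<open>t \<in> {d + 1, d + 2}\<close>, and this choice of \<open>t\<close> is Pascal's recurrence for the number of words
  with zero slack. The slope for which words of length \<open>n + 1\<close> attain the bound is \<open>rho n\<close>.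
  Reversal and complementation of words carry the result to the other two patterns.
\<close>

section \<open>Inversions and avoidance for lists; splitting at the maximum\<close>

text \<open>Letters come from an arbitrary linear order, so that the entries after the maximum form
  a word of the same kind without renumbering.\<close>

fun linv :: "'a::linorder list \<Rightarrow> nat" where
  "linv [] = 0"
| "linv (x # xs) = length (filter (\<lambda>y. y < x) xs) + linv xs"

fun lavoids :: "'a::linorder list \<Rightarrow> bool" where
  "lavoids (x # y # zs) \<longleftrightarrow> \<not> (x < y \<and> (\<exists>z\<in>set zs. y < z)) \<and> lavoids (y # zs)"
| "lavoids _ \<longleftrightarrow> True"

definition cross :: "'a::linorder list \<Rightarrow> 'a list \<Rightarrow> nat" where
  "cross xs ys = (\<Sum>x\<leftarrow>xs. length (filter (\<lambda>y. y < x) ys))"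

lemma linv_append: "linv (xs @ ys) = linv xs + linv ys + cross xs ys"
  by (induction xs) (auto simp: cross_def)

lemma cross_eq_0_iff: "cross xs ys = 0 \<longleftrightarrow> (\<forall>x\<in>set xs. \<forall>y\<in>set ys. x \<le> y)"
  by (induction xs) (auto simp: cross_def filter_empty_conv not_less)

lemma linv_strictly_decreasing: "sorted_wrt (>) xs \<Longrightarrow> linv xs = length xs choose 2"
proof (induction xs)
  case (Cons x xs)
  then have "filter (\<lambda>y. y < x) xs = xs"
    by (auto simp: filter_id_conv)
  with Cons show ?case
    by (simp add: numeral_2_eq_2)
qed simp

text \<open>An ascent inside \<open>as\<close> is completed to the pattern by \<open>m\<close>. An
  ascent from \<open>as\<close> into \<open>m\<close> has nothing larger after it, and the step out
  of \<open>m\<close> is a descent, so neither constrains \<open>ys\<close>.\<close>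

lemma lavoids_append_max:
  assumes "distinct (as @ m # ys)" "\<forall>x\<in>set (as @ m # ys). x \<le> m"
  shows "lavoids (as @ m # ys) \<longleftrightarrow> sorted_wrt (>) as \<and> lavoids ys"
  using assms
proof (induction as rule: induct_list012)
  case 1
  then show ?case by (cases ys) (auto simp: not_less)
next
  case (2 a)
  have "lavoids (m # ys) \<longleftrightarrow> lavoids ys"
    using 2 by (cases ys) (auto simp: not_less)
  with 2 show ?case by (auto simp: not_less)
next
  case (3 a b as)
  have "a \<noteq> b" "b < m" using 3(3,4) by auto
  moreover have "lavoids ((b # as) @ m # ys) \<longleftrightarrow> sorted_wrt (>) (b # as) \<and> lavoids ys"
    using 3 by auto
  ultimately show ?case by (force simp: not_less)
qed

lemma linv_append_max:
  assumes "sorted_wrt (>) as" "distinct (as @ m # ys)" "\<forall>x\<in>set (as @ m # ys). x \<le> m"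
  shows "linv (as @ m # ys) = (length as choose 2) + length ys + linv ys + cross as ys"
proof -
  have "filter (\<lambda>y. y < m) ys = ys"
    using assms by (auto simp: filter_id_conv order_less_le)
  moreover have "cross as (m # ys) = cross as ys"
    using assms(3) by (induction as) (auto simp: cross_def)
  ultimately show ?thesis
    using assms(1) by (simp add: linv_append linv_strictly_decreasing)
qed

lemma lavoids_max_decomp:
  assumes "distinct xs" "lavoids xs" "xs \<noteq> []"
  obtains as ys where "xs = as @ Max (set xs) # ys" "sorted_wrt (>) as" "lavoids ys"
    "linv xs = (length as choose 2) + length ys + linv ys + cross as ys"
proof -
  have "Max (set xs) \<in> set xs" using assms by simp
  then obtain as ys where xs: "xs = as @ Max (set xs) # ys" by (meson split_list)
  have d: "distinct (as @ Max (set xs) # ys)" using assms(1) xs by simp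
  have m: "\<forall>x\<in>set (as @ Max (set xs) # ys). x \<le> Max (set xs)" using xs by (metis List.finite_set Max_ge)
  have "sorted_wrt (>) as \<and> lavoids ys"
    using lavoids_append_max[OF d m] assms(2) xs by simp
  moreover from this have "linv xs = (length as choose 2) + length ys + linv ys + cross as ys"
    using linv_append_max[OF _ d m] xs by simp
  ultimately show ?thesis using that xs by blast
qed

section \<open>The tangent bounds for the inversion number\<close>

text \<open>
  \<open>shell d\<close> is the length of the shortest words attaining the tangent bound at slope \<open>d\<close>;
  \<open>offset\<close> is the function \<open>K\<close> above, and \<open>excess\<close> the slack.
\<close>

fun shell :: "nat \<Rightarrow> nat" where
  "shell 0 = 0"
| "shell (Suc d) = shell d + d + 2"

fun offset :: "nat \<Rightarrow> nat" where
  "offset 0 = 0"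
| "offset (Suc d) = offset d + shell (Suc d)"

lemma shell_closed: "2 * shell d = d * (d + 3)"
  by (induction d) (auto simp: algebra_simps)

lemma offset_closed: "6 * offset d = d * (d + 1) * (d + 5)"
proof (induction d)
  case (Suc d)
  have "6 * offset (Suc d) = 6 * offset d + 3 * (2 * shell (Suc d))" by simp
  then show ?case unfolding Suc shell_closed by (simp add: algebra_simps)
qed simp

definition excess :: "nat \<Rightarrow> 'a::linorder list \<Rightarrow> int" where
  "excess d xs = int (linv xs) + int (offset d) - int d * int (length xs)"

lemma int_choose_two: "2 * int (n choose 2) = int n * (int n - 1)"
proof -
  have "even (n * (n - 1))" by (cases n) auto
  then have "2 * (n choose 2) = n * (n - 1)" by (simp add: choose_two)
  then have "2 * int (n choose 2) = int n * int (n - 1)" by (metis of_nat_mult of_nat_numeral)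
  then show ?thesis by (cases n) auto
qed

text \<open>The \<open>length ys\<close> inversions headed by the maximum are what lower the slope
  from \<open>d + 1\<close> to \<open>d\<close> on \<open>ys\<close>. The increment
  \<open>shell (Suc d)\<close> of \<open>offset\<close> is the constant for which the remaining
  quadratic in \<open>length as\<close> splits into two consecutive integers. Doubling clears the
  halves.\<close>

lemma excess_Suc:
  assumes "linv (as @ m # ys) = (length as choose 2) + length ys + linv ys + cross as ys"
  shows "2 * excess (Suc d) (as @ m # ys) = 2 * excess d ys + 2 * int (cross as ys)
    + (int (length as) - int d - 1) * (int (length as) - int d - 2)"
proof -
  have s: "2 * int (shell (Suc d)) = (int d + 1) * (int d + 4)"
    using arg_cong[OF shell_closed[of "Suc d"], of int] by (simp add: algebra_simps)
  have "2 * excess (Suc d) (as @ m # ys) =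
     2 * int (length as choose 2) + 2 * int (length ys) + 2 * int (linv ys) + 2 * int (cross as ys)
     + 2 * int (offset d) + 2 * int (shell (Suc d))
     - 2 * (int d + 1) * (int (length as) + 1 + int (length ys))"
    unfolding excess_def assms by (simp add: algebra_simps del: shell.simps)
  then show ?thesis
    unfolding int_choose_two s excess_def by (simp add: algebra_simps)
qed

text \<open>Integrality matters: the product is negative for real \<open>k\<close> strictly between
  0 and 1.\<close>

lemma consecutive_product_nonneg: "0 \<le> (k::int) * (k - 1)"
  by (cases "k \<le> 0") (auto simp: mult_nonpos_nonpos)

text \<open>Induction on the slope rather than on the word: at slope 0 the excess is the inversion
  number itself, and \<open>excess_Suc\<close> passes from \<open>xs\<close> to the part after its
  maximum.\<close>

lemma excess_nonneg: "distinct xs \<Longrightarrow> lavoids xs \<Longrightarrow> 0 \<le> excess d xs"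
proof (induction d arbitrary: xs)
  case (Suc d)
  show ?case
  proof (cases "xs = []")
    case False
    obtain as m ys where xs: "xs = as @ m # ys" "lavoids ys"
        "linv xs = (length as choose 2) + length ys + linv ys + cross as ys"
      using lavoids_max_decomp[OF Suc.prems False] by metis
    have "0 \<le> excess d ys" using Suc xs by auto
    then show ?thesis
      using excess_Suc[OF xs(3)[unfolded xs(1)], of d] xs(1)
        consecutive_product_nonneg[of "int (length as) - int d - 1"] by simp
  qed (simp add: excess_def)
qed (simp add: excess_def)

section \<open>Counting the words that attain a tangent bound\<close>

text \<open>Only the letters of \<open>L\<close> matter; a list is used so that, once sorted, it can
  be cut with \<open>take\<close> and \<open>drop\<close>.\<close>

definition tight :: "nat \<Rightarrow> 'a::linorder list \<Rightarrow> 'a list set" where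
  "tight d L = {xs. set xs = set L \<and> distinct xs \<and> lavoids xs \<and> excess d xs = 0}"

lemma finite_tight [simp]: "finite (tight d L)"
proof (rule finite_subset)
  show "tight d L \<subseteq> {xs. set xs \<subseteq> set L \<and> length xs = card (set L)}"
    by (auto simp: tight_def) (metis distinct_card)
qed (simp add: finite_lists_length_eq)

lemma excess_Suc_eq_0_iff:
  assumes "linv (as @ m # ys) = (length as choose 2) + length ys + linv ys + cross as ys"
    and "0 \<le> excess d ys"
  shows "excess (Suc d) (as @ m # ys) = 0 \<longleftrightarrow>
    excess d ys = 0 \<and> cross as ys = 0 \<and> length as \<in> {d + 1, d + 2}"
proof -
  let ?k = "int (length as) - int d - 1"
  have "2 * excess (Suc d) (as @ m # ys) = 2 * excess d ys + 2 * int (cross as ys) + ?k * (?k - 1)"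
    using excess_Suc[OF assms(1), of d] by simp
  moreover have "?k * (?k - 1) = 0 \<longleftrightarrow> length as \<in> {d + 1, d + 2}" by auto
  ultimately show ?thesis
    using assms(2) consecutive_product_nonneg[of ?k] by linarith
qed

text \<open>For increasing \<open>L\<close> this undoes the splitting at the maximum of a tight
  word.\<close>

definition extend :: "'a::linorder list \<Rightarrow> nat \<Rightarrow> 'a list \<Rightarrow> 'a list" where
  "extend L t ys = rev (take t L) @ last L # ys"

text \<open>Vanishing \<open>cross\<close> puts every letter before the maximum below every letter
  after it, so the length of the decreasing prefix determines the prefix.\<close>

lemma tight_Suc:
  assumes "sorted_wrt (<) L" "L \<noteq> []"
  shows "tight (Suc d) L =
    (\<Union>t\<in>{t\<in>{d + 1, d + 2}. t < length L}. extend L t ` tight d (butlast (drop t L)))"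
    (is "_ = ?R")
proof (intro equalityI subsetI)
  fix xs assume "xs \<in> tight (Suc d) L"
  then have xs: "set xs = set L" "distinct xs" "lavoids xs" "excess (Suc d) xs = 0"
    by (auto simp: tight_def)
  then have ne: "xs \<noteq> []" using assms(2) by auto
  obtain as ys where d: "xs = as @ Max (set xs) # ys" "sorted_wrt (>) as" "lavoids ys"
    "linv xs = (length as choose 2) + length ys + linv ys + cross as ys"
    using lavoids_max_decomp[OF xs(2,3) ne] by blast
  define m where "m = Max (set xs)"
  have xs': "xs = as @ m # ys" using d(1) m_def by simp
  have dys: "distinct ys" using xs' xs(2) by simp
  have t: "excess d ys = 0" "cross as ys = 0" "length as \<in> {d + 1, d + 2}"
    using excess_Suc_eq_0_iff[of as m ys d] d(4) excess_nonneg[OF dys d(3)] xs(4) xs' by auto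
  have le: "\<forall>x\<in>set xs. x \<le> m" unfolding m_def by simp
  have dist: "distinct as" "set as \<inter> set ys = {}" "m \<notin> set as" "m \<notin> set ys" using xs(2) xs' by auto
  \<comment> \<open>An increasing list is determined by its letters, so this list must be
    \<open>L\<close>; \<open>sort ys\<close> gives the letters of \<open>ys\<close> in the order in
    which they occur in \<open>L\<close>.\<close>
  have "sorted_wrt (<) (rev as @ sort ys @ [m])"
    using d(2) dys le xs' dist cross_eq_0_iff[of as ys] t(2)
    by (force simp: sorted_wrt_append sorted_wrt_rev strict_sorted_iff order_less_le)
  moreover have "set (rev as @ sort ys @ [m]) = set L" using xs(1) xs' by auto
  ultimately have L: "L = rev as @ sort ys @ [m]"
    using assms(1) by (metis strict_sorted_equal)
  have "take (length as) L = rev as" "last L = m" "butlast (drop (length as) L) = sort ys"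
    "length as < length L" using L by auto
  moreover have "ys \<in> tight d (sort ys)" using d(3) dys t(1) by (simp add: tight_def)
  ultimately show "xs \<in> ?R" using t(3) xs' by (force simp: extend_def)
next
  fix xs assume "xs \<in> ?R"
  then obtain t ys where t: "t \<in> {d + 1, d + 2}" "t < length L" "ys \<in> tight d (butlast (drop t L))"
    "xs = extend L t ys" by auto
  define as cs m where "as = rev (take t L)" and "cs = butlast (drop t L)" and "m = last L"
  have L: "L = rev as @ cs @ [m]"
  proof -
    have "drop t L = cs @ [m]"
      unfolding cs_def m_def using t(2) by (metis append_butlast_last_id drop_eq_Nil last_drop not_less)
    then show ?thesis unfolding as_def by (metis append_take_drop_id rev_rev_ident)
  qed
  have xs: "xs = as @ m # ys" using t(4) by (simp add: extend_def as_def m_def)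
  have ys: "set ys = set cs" "distinct ys" "lavoids ys" "excess d ys = 0"
    using t(3) by (auto simp: tight_def cs_def)
  have s: "sorted_wrt (<) (rev as @ cs @ [m])" using assms(1) L by simp
  have "distinct (rev as @ cs @ [m])" using s by (simp add: strict_sorted_iff)
  then have dist: "distinct (as @ m # ys)" using ys by auto
  have le: "\<forall>x\<in>set (as @ m # ys). x \<le> m"
    using s ys by (auto simp: sorted_wrt_append order_less_le)
  have sas: "sorted_wrt (>) as" using s by (auto simp: sorted_wrt_append sorted_wrt_rev)
  have "cross as ys = 0"
    unfolding cross_eq_0_iff using s ys by (auto simp: sorted_wrt_append order_less_le)
  moreover have "length as = t" using t(2) by (simp add: as_def)
  ultimately have "excess (Suc d) (as @ m # ys) = 0"
    using excess_Suc_eq_0_iff[OF linv_append_max[OF sas dist le], of d] t(1) ys(4) by auto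
  moreover have "lavoids (as @ m # ys)" using lavoids_append_max[OF dist le] sas ys by simp
  moreover have "set (as @ m # ys) = set L" using L ys by auto
  ultimately show "xs \<in> tight (Suc d) L" using dist xs by (simp add: tight_def)
qed

lemma ibinom_nat: "ibinom (int a) (int b) = int (a choose b)"
  by (auto simp: ibinom_def)

text \<open>By the zero convention this holds for negative \<open>r\<close> too, which spares the
  counting any boundary cases.\<close>

lemma ibinom_Suc: "ibinom (int (Suc d)) r = ibinom (int d) r + ibinom (int d) (r - 1)"
proof (cases "r \<le> 0")
  case True
  then show ?thesis by (auto simp: ibinom_def)
next
  case False
  then obtain k where "r = int k" "k \<noteq> 0" by (cases r) auto
  then obtain l where "r = int (Suc l)" "r - 1 = int l" by (cases k) auto
  then show ?thesis by (simp only: ibinom_nat binomial_Suc_Suc of_nat_add add.commute)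
qed

lemma card_tight_Suc:
  assumes "sorted_wrt (<) L" "L \<noteq> []"
  shows "card (tight (Suc d) L) =
    (\<Sum>t\<in>{t\<in>{d + 1, d + 2}. t < length L}. card (tight d (butlast (drop t L))))"
proof -
  have "extend L t ` tight d (butlast (drop t L)) \<inter> extend L u ` tight d (butlast (drop u L)) = {}"
    if "t < length L" "u < length L" "t \<noteq> u" for t u
  proof -
    have nin: "last L \<notin> set (take k L)" if "k < length L" for k
    proof -
      have "last L \<in> set (drop k L)" using that by (metis drop_eq_Nil last_drop last_in_set not_less)
      moreover have "distinct L" using assms(1) by (simp add: strict_sorted_iff)
      ultimately show ?thesis using set_take_disj_set_drop_if_distinct[of L k k] by auto
    qed
    \<comment> \<open>\<open>t\<close> is recovered from the word as the position of its maximum\<close>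
    have recover: "takeWhile (\<lambda>x. x \<noteq> last L) (extend L k ys) = rev (take k L)" if "k < length L" for k ys
      unfolding extend_def using nin[OF that] by (subst takeWhile_append2) auto
    have "extend L t ys \<noteq> extend L u zs" for ys zs
    proof
      assume "extend L t ys = extend L u zs"
      then have "rev (take t L) = rev (take u L)"
        using recover[OF that(1)] recover[OF that(2)] by metis
      then have "length (take t L) = length (take u L)" by simp
      with that show False by simp
    qed
    then show ?thesis by auto
  qed
  moreover have "inj_on (extend L t) A" for t A by (simp add: inj_on_def extend_def)
  ultimately show ?thesis
    unfolding tight_Suc[OF assms] by (subst card_UN_disjoint) (auto simp: card_image)
qed

lemma linv_eq_0_iff: "linv xs = 0 \<longleftrightarrow> sorted xs"
  by (induction xs) (auto simp: filter_empty_conv not_less)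

text \<open>At slope 0 the word has no inversions, hence is increasing, and three increasing letters
  already contain the pattern.\<close>

lemma tight_0:
  assumes "sorted_wrt (<) L"
  shows "tight 0 L = (if length L \<le> 2 then {L} else {})"
proof -
  have "lavoids L \<longleftrightarrow> length L \<le> 2"
    using assms by (cases L rule: lavoids.cases) (auto split: list.splits simp: Suc_le_eq neq_Nil_conv)
  moreover have "set xs = set L \<and> distinct xs \<and> sorted xs \<longleftrightarrow> xs = L" for xs
    using assms by (metis strict_sorted_equal strict_sorted_iff)
  moreover have "tight 0 L = {xs. (set xs = set L \<and> distinct xs \<and> sorted xs) \<and> lavoids xs}"
    by (auto simp: tight_def excess_def linv_eq_0_iff)
  ultimately show ?thesis by auto
qed

text \<open>As a generating function in \<open>r\<close> the count is (1 + x + x^2) (1 + x)^d: slope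
  0 allows lengths 0, 1 and 2, and each further slope contributes a factor 1 + x for the two choices
  of \<open>t\<close>.\<close>

lemma card_tight:
  fixes L :: "'a::linorder list" and d :: nat
  defines "r \<equiv> int (length L) - int (shell d)"
  assumes "sorted_wrt (<) L"
  shows "int (card (tight d L)) =
    ibinom (int d) r + ibinom (int d) (r - 1) + ibinom (int d) (r - 2)"
  unfolding r_def using assms(2)
proof (induction d arbitrary: L)
  case 0
  then show ?case by (auto simp: tight_0 ibinom_def)
next
  case (Suc d)
  let ?r = "int (length L) - int (shell (Suc d))"
  let ?F = "\<lambda>r. ibinom (int d) r + ibinom (int d) (r - 1) + ibinom (int d) (r - 2)"
  \<comment> \<open>For \<open>t\<close> at least \<open>length L\<close> the shifted argument is
    negative, so the formula also covers the excluded \<open>t\<close>.\<close>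
  have zero: "?F r = 0" if "r < 0" for r using that by (simp add: ibinom_def)
  have part: "(if t < length L then int (card (tight d (butlast (drop t L)))) else 0)
      = ?F (int (length L) - int t - 1 - int (shell d))" for t
  proof (cases "t < length L")
    case True
    have "sorted_wrt (<) (butlast (drop t L))"
      using Suc.prems by (simp add: butlast_conv_take sorted_wrt_drop sorted_wrt_take)
    then show ?thesis using Suc.IH[of "butlast (drop t L)"] True by (simp add: of_nat_diff algebra_simps)
  next
    case False
    then show ?thesis using zero[of "int (length L) - int t - 1 - int (shell d)"] by simp
  qed
  have "int (card (tight (Suc d) L)) =
    (if d + 1 < length L then int (card (tight d (butlast (drop (d + 1) L)))) else 0)
    + (if d + 2 < length L then int (card (tight d (butlast (drop (d + 2) L)))) else 0)"
  proof (cases "L = []")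
    case True
    then show ?thesis by (simp add: tight_def excess_def)
  next
    case False
    have "{t \<in> {d + 1, d + 2}. t < length L} = (if d + 2 < length L then {d + 1, d + 2} else
        if d + 1 < length L then {d + 1} else {})" by auto
    then show ?thesis unfolding card_tight_Suc[OF Suc.prems False] by simp
  qed
  \<comment> \<open>Taking \<open>t = d + 1\<close> removes \<open>d + 2\<close> letters, exactly
    the growth of \<open>shell\<close>, so \<open>r\<close> is unchanged; \<open>t = d + 2\<close>
    lowers it by one.\<close>
  also have "\<dots> = ?F ?r + ?F (?r - 1)"
    unfolding part by (simp add: algebra_simps)
  also have "\<dots> = ibinom (int (Suc d)) ?r + ibinom (int (Suc d)) (?r - 1) + ibinom (int (Suc d)) (?r - 2)"
    unfolding ibinom_Suc by simp
  finally show ?case .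
qed

section \<open>Translation between permutations and words\<close>

definition word :: "nat \<Rightarrow> (nat \<Rightarrow> nat) \<Rightarrow> nat list" where
  "word N \<pi> = map \<pi> [1..<N + 1]"

lemma length_word [simp]: "length (word N \<pi>) = N"
  by (simp add: word_def)

lemma bij_betw_word: "bij_betw (word N) (Sym N) {xs. set xs = {1..N} \<and> distinct xs}"
proof (rule bij_betwI')
  fix \<pi> \<tau> assume "\<pi> \<in> Sym N" "\<tau> \<in> Sym N"
  then have out: "\<pi> i = \<tau> i" if "i \<notin> {1..N}" for i
    using that by (simp add: Sym_def permutes_not_in)
  have "word N \<pi> = word N \<tau> \<longleftrightarrow> (\<forall>i\<in>{1..N}. \<pi> i = \<tau> i)"
    by (auto simp: word_def simp del: upt_Suc)
  also have "\<dots> \<longleftrightarrow> \<pi> = \<tau>" using out by (metis ext)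
  finally show "(word N \<pi> = word N \<tau>) = (\<pi> = \<tau>)" .
next
  fix \<pi> assume "\<pi> \<in> Sym N"
  then have p: "\<pi> permutes {1..N}" by (simp add: Sym_def)
  have "{Suc 0..<Suc N} = {1..N}" by auto
  then show "word N \<pi> \<in> {xs. set xs = {1..N} \<and> distinct xs}"
    using permutes_image[OF p] permutes_inj_on[OF p] by (simp add: word_def distinct_map del: upt_Suc)
next
  fix xs :: "nat list" assume "xs \<in> {xs. set xs = {1..N} \<and> distinct xs}"
  then have xs: "set xs = {1..N}" "distinct xs" by auto
  have len: "length xs = N" using distinct_card[OF xs(2)] xs(1) by simp
  define \<pi> where "\<pi> i = (if i \<in> {1..N} then xs ! (i - 1) else i)" for i
  have w: "word N \<pi> = xs"
    by (rule nth_equalityI) (auto simp: word_def len \<pi>_def simp del: upt_Suc)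
  have "inj_on \<pi> {1..N}"
    by (rule inj_onI) (use xs len in \<open>auto simp: \<pi>_def nth_eq_iff_index_eq\<close>)
  moreover have "\<pi> ` {1..N} = {1..N}"
  proof -
    have "\<pi> ` {1..N} = set (word N \<pi>)" by (simp add: word_def atLeastLessThanSuc_atLeastAtMost del: upt_Suc)
    then show ?thesis using w xs by simp
  qed
  ultimately have "\<pi> permutes {1..N}"
    by (intro bij_imp_permutes) (auto simp: bij_betw_def \<pi>_def)
  then show "\<exists>\<pi>\<in>Sym N. xs = word N \<pi>" using w by (auto simp: Sym_def)
qed

text \<open>The left end \<open>a\<close> is kept general so that the induction can strip off the
  first position.\<close>

lemma linv_map_upt: "linv (map f [a..<b]) = card {(i, j). a \<le> i \<and> i < j \<and> j < b \<and> f i > f j}"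
  for f :: "nat \<Rightarrow> 'a::linorder"
proof (induction "b - a" arbitrary: a)
  case 0
  then have "{(i, j). a \<le> i \<and> i < j \<and> j < b \<and> f i > f j} = {}" by auto
  moreover have "[a..<b] = []" using 0 by simp
  ultimately show ?case by (simp only: list.map linv.simps card.empty)
next
  case (Suc k)
  let ?J = "{j. a < j \<and> j < b \<and> f j < f a}"
  let ?B = "{(i, j). Suc a \<le> i \<and> i < j \<and> j < b \<and> f i > f j}"
  have "length (filter (\<lambda>y. y < f a) (map f [Suc a..<b])) = card ?J"
  proof -
    have "length (filter (\<lambda>y. y < f a) (map f [Suc a..<b])) = length (filter (\<lambda>j. f j < f a) [Suc a..<b])"
      by (simp add: filter_map o_def)
    also have "\<dots> = card (set (filter (\<lambda>j. f j < f a) [Suc a..<b]))"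
      by (rule distinct_card[symmetric]) simp
    also have "set (filter (\<lambda>j. f j < f a) [Suc a..<b]) = ?J" by auto
    finally show ?thesis .
  qed
  moreover have "{(i, j). a \<le> i \<and> i < j \<and> j < b \<and> f i > f j} = Pair a ` ?J \<union> ?B"
    by (auto simp: image_iff Suc_le_eq le_less)
  moreover have "finite ?B" by (rule finite_subset[of _ "{..<b} \<times> {..<b}"]) auto
  then have "card (Pair a ` ?J \<union> ?B) = card ?J + card ?B"
    by (subst card_Un_disjoint) (auto simp: card_image inj_on_def)
  moreover have "linv (map f [Suc a..<b]) = card ?B" using Suc by auto
  moreover have "[a..<b] = a # [Suc a..<b]" using Suc(2) by (simp add: upt_conv_Cons)
  ultimately show ?case by simp
qed

lemma inversions_word: "inversions N \<pi> = linv (word N \<pi>)"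
  unfolding inversions_def word_def linv_map_upt by (simp add: less_Suc_eq_le)

lemma lavoids_map_upt:
  "lavoids (map f [a..<b]) \<longleftrightarrow> \<not> (\<exists>i j. a \<le> i \<and> i + 1 < j \<and> j < b \<and> f i < f (i + 1) \<and> f (i + 1) < f j)"
  for f :: "nat \<Rightarrow> 'a::linorder"
proof (induction "b - a" arbitrary: a)
  case (Suc k)
  show ?case
  proof (cases "Suc a < b")
    case True
    have u: "[a..<b] = a # Suc a # [Suc (Suc a)..<b]" "[Suc a..<b] = Suc a # [Suc (Suc a)..<b]"
      using True by (simp_all add: upt_conv_Cons)
    have "lavoids (map f [a..<b]) \<longleftrightarrow>
       \<not> (f a < f (Suc a) \<and> (\<exists>j. Suc a < j \<and> j < b \<and> f (Suc a) < f j)) \<and> lavoids (map f [Suc a..<b])"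
      unfolding u by (auto simp: Suc_le_eq)
    also have "lavoids (map f [Suc a..<b]) \<longleftrightarrow>
       \<not> (\<exists>i j. Suc a \<le> i \<and> i + 1 < j \<and> j < b \<and> f i < f (i + 1) \<and> f (i + 1) < f j)"
      using Suc by auto
    moreover have "a \<le> i \<longleftrightarrow> i = a \<or> Suc a \<le> i" for i by auto
    ultimately show ?thesis by auto
  next
    case False
    then have "[a..<b] = [a]" using Suc(2) by (simp add: upt_conv_Cons)
    then show ?thesis using False by auto
  qed
qed auto

lemma avoids_12_3_word: "avoids_12_3 N \<pi> \<longleftrightarrow> lavoids (word N \<pi>)"
  unfolding avoids_12_3_def word_def lavoids_map_upt by (simp add: less_Suc_eq_le)

section \<open>The minimum for the pattern 12-3\<close>

lemma finite_Sym_av: "finite (Sym_av N av)"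
  by (simp add: Sym_av_def Sym_def finite_permutations)

text \<open>For these \<open>N\<close> some word is tight at slope \<open>d\<close>, so the tangent
  bound is the minimum and the minimisers are exactly the tight words.\<close>

lemma
  assumes lo: "shell d \<le> N" and hi: "N < shell (Suc d)"
  shows mininv_12_3: "int (mininv N avoids_12_3) = int d * int N - int (offset d)"
    and card_Yset_12_3: "int (card (Yset N avoids_12_3)) =
      ibinom (int d) (int N - int (shell d)) + ibinom (int d + 1) (int N - int (shell d) - 1)"
proof -
  define L where "L = [1..<N + 1]"
  have L: "sorted_wrt (<) L" "set L = {1..N}" "length L = N"
    by (auto simp: L_def simp del: upt_Suc)
  define r where "r = int N - int (shell d)"
  have bij: "bij_betw (word N) {\<pi> \<in> Sym_av N avoids_12_3. excess d (word N \<pi>) = 0} (tight d L)"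
  proof (rule bij_betw_subset[OF bij_betw_word])
    show "word N ` {\<pi> \<in> Sym_av N avoids_12_3. excess d (word N \<pi>) = 0} = tight d L"
    proof -
      have "tight d L = {xs \<in> word N ` Sym N. lavoids xs \<and> excess d xs = 0}"
        using bij_betw_imp_surj_on[OF bij_betw_word[of N]] by (auto simp: tight_def L(2))
      then show ?thesis by (auto simp: Sym_av_def avoids_12_3_word)
    qed
  qed (auto simp: Sym_av_def)
  \<comment> \<open>Pascal's rule merges the last two of the three terms of
    \<open>card_tight\<close>.\<close>
  have card: "int (card (tight d L)) = ibinom (int d) r + ibinom (int d + 1) (r - 1)"
    using card_tight[OF L(1), of d] ibinom_Suc[of d "r - 1"] L(3) by (simp add: r_def add.commute)
  have ex: "excess d (word N \<pi>) = int (inversions N \<pi>) + int (offset d) - int d * int N" for \<pi>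
    by (simp add: excess_def inversions_word)
  have "0 < int (card (tight d L))"
  proof -
    \<comment> \<open>The first binomial is positive up to \<open>r = d\<close>; the second covers
      the remaining value \<open>d + 1\<close>.\<close>
    have "0 \<le> r" "r \<le> int d + 1" using lo hi by (auto simp: r_def)
    moreover have "0 \<le> ibinom (int d) r" "0 \<le> ibinom (int d + 1) (r - 1)" by (simp_all add: ibinom_def)
    moreover have "0 < ibinom (int d) r" if "r \<le> int d" using that \<open>0 \<le> r\<close> by (simp add: ibinom_def nat_le_iff)
    moreover have "0 < ibinom (int d + 1) (r - 1)" if "r = int d + 1"
      using that by (simp add: ibinom_def)
    ultimately show ?thesis unfolding card by linarith
  qed
  then obtain \<pi> where \<pi>: "\<pi> \<in> Sym_av N avoids_12_3" "excess d (word N \<pi>) = 0"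
    using bij by (fastforce simp: bij_betw_def card_gt_0_iff)
  have lb: "inversions N \<pi> \<le> inversions N \<tau>" if "\<tau> \<in> Sym_av N avoids_12_3" for \<tau>
  proof -
    have "distinct (word N \<tau>)" "lavoids (word N \<tau>)"
      using that bij_betw_word[of N] by (auto simp: Sym_av_def avoids_12_3_word bij_betw_def)
    then show ?thesis using excess_nonneg[of "word N \<tau>" d] \<pi>(2) by (simp add: ex)
  qed
  have min: "mininv N avoids_12_3 = inversions N \<pi>"
    unfolding mininv_def using \<pi>(1) lb by (intro Min_eqI) (auto simp: finite_Sym_av)
  then show *: "int (mininv N avoids_12_3) = int d * int N - int (offset d)"
    using \<pi>(2) by (simp add: ex)
  have "Yset N avoids_12_3 = {\<pi> \<in> Sym_av N avoids_12_3. excess d (word N \<pi>) = 0}"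
    unfolding Yset_def ex using * by auto
  then show "int (card (Yset N avoids_12_3)) =
      ibinom (int d) (int N - int (shell d)) + ibinom (int d + 1) (int N - int (shell d) - 1)"
    using bij_betw_same_card[OF bij] card by (simp add: r_def)
qed

section \<open>Reversal and complementation\<close>

definition flip :: "nat \<Rightarrow> nat \<Rightarrow> nat" where
  "flip N i = (if i \<in> {1..N} then N + 1 - i else i)"

lemma flip_flip [simp]: "flip N (flip N i) = i"
  by (auto simp: flip_def)

lemma flip_permutes: "flip N permutes {1..N}"
proof (rule bij_imp_permutes)
  show "bij_betw (flip N) {1..N} {1..N}"
    by (rule bij_betw_byWitness[where f' = "flip N"]) (auto simp: flip_def)
qed (auto simp: flip_def)

text \<open>Each pair of entries is inverted in exactly one of the two words. In the induction,
  \<open>x\<close> moves to the end and is then inverted with the larger entries instead of the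
  smaller ones.\<close>

lemma linv_rev: "distinct xs \<Longrightarrow> linv (rev xs) + linv xs = length xs choose 2"
proof (induction xs)
  case (Cons x xs)
  have "cross (rev xs) [x] = length (filter (\<lambda>y. \<not> y < x) xs)"
    using Cons.prems by (induction xs) (auto simp: cross_def not_less)
  then show ?case
    using Cons sum_length_filter_compl[of "\<lambda>y. y < x" xs]
    by (simp add: linv_append numeral_2_eq_2)
qed simp

lemma linv_map_antitone:
  assumes "distinct xs" "\<And>x y. x \<in> set xs \<Longrightarrow> y \<in> set xs \<Longrightarrow> f x < f y \<longleftrightarrow> y < x"
  shows "linv (map f xs) + linv xs = length xs choose 2"
  using assms
proof (induction xs)
  case (Cons x xs)
  have "length (filter (\<lambda>y. y < f x) (map f xs)) = length (filter (\<lambda>y. \<not> y < x) xs)"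
  proof -
    have "filter (\<lambda>y. f y < f x) xs = filter (\<lambda>y. \<not> y < x) xs"
      by (rule filter_cong) (use Cons.prems in \<open>auto simp: not_less order_less_le\<close>)
    then show ?thesis by (simp add: filter_map o_def)
  qed
  then show ?case
    using Cons sum_length_filter_compl[of "\<lambda>y. y < x" xs] by (simp add: numeral_2_eq_2)
qed simp

lemma word_Sym: "\<pi> \<in> Sym N \<Longrightarrow> set (word N \<pi>) = {1..N} \<and> distinct (word N \<pi>)"
  using bij_betw_word[of N] by (auto simp: bij_betw_def)

lemma inversions_reverse:
  assumes "\<pi> \<in> Sym N"
  shows "inversions N (\<pi> \<circ> flip N) + inversions N \<pi> = N choose 2"
proof -
  have "word N (\<pi> \<circ> flip N) = rev (word N \<pi>)"
    by (rule nth_equalityI) (auto simp: word_def rev_nth flip_def Suc_diff_Suc simp del: upt_Suc)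
  then show ?thesis
    using linv_rev[of "word N \<pi>"] word_Sym[OF assms]
    by (simp add: inversions_word)
qed

lemma inversions_complement:
  assumes "\<pi> \<in> Sym N"
  shows "inversions N (flip N \<circ> \<pi>) + inversions N \<pi> = N choose 2"
proof -
  have "linv (map (flip N) (word N \<pi>)) + linv (word N \<pi>) = length (word N \<pi>) choose 2"
  proof (rule linv_map_antitone)
    fix x y assume "x \<in> set (word N \<pi>)" "y \<in> set (word N \<pi>)"
    then have "x \<in> {1..N}" "y \<in> {1..N}" using word_Sym[OF assms] by auto
    then show "flip N x < flip N y \<longleftrightarrow> y < x" by (auto simp: flip_def)
  qed (use word_Sym[OF assms] in blast)
  moreover have "word N (flip N \<circ> \<pi>) = map (flip N) (word N \<pi>)" by (simp add: word_def)
  ultimately show ?thesis by (simp add: inversions_word)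
qed

text \<open>Positions \<open>i\<close>, \<open>i + 1\<close>, \<open>j\<close> of an occurrence of
  12-3 become \<open>N - i + 1\<close>, \<open>N - i\<close>, \<open>N + 1 - j\<close>, so adjacency
  survives.\<close>

lemma avoids_3_21_reverse: "avoids_3_21 N (\<pi> \<circ> flip N) \<longleftrightarrow> avoids_12_3 N \<pi>"
proof -
  have "(\<exists>i j. 1 \<le> i \<and> i < j \<and> j + 1 \<le> N \<and> \<pi> (flip N i) > \<pi> (flip N j) \<and> \<pi> (flip N j) > \<pi> (flip N (j + 1)))
    \<longleftrightarrow> (\<exists>i j. 1 \<le> i \<and> i + 1 < j \<and> j \<le> N \<and> \<pi> i < \<pi> (i + 1) \<and> \<pi> (i + 1) < \<pi> j)" (is "?l \<longleftrightarrow> ?r")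
  proof
    assume ?l
    then obtain i j where *: "1 \<le> i" "i < j" "j + 1 \<le> N"
      "\<pi> (flip N i) > \<pi> (flip N j)" "\<pi> (flip N j) > \<pi> (flip N (j + 1))" by blast
    then have "flip N i = N + 1 - i" "flip N j = (N - j) + 1" "flip N (j + 1) = N - j"
      by (auto simp: flip_def)
    with * show ?r by (intro exI[of _ "N - j"] exI[of _ "N + 1 - i"]) auto
  next
    assume ?r
    then obtain i j where *: "1 \<le> i" "i + 1 < j" "j \<le> N" "\<pi> i < \<pi> (i + 1)" "\<pi> (i + 1) < \<pi> j" by blast
    then have "flip N (N + 1 - j) = j" "flip N (N - i) = i + 1" "flip N (N - i + 1) = i"
      by (auto simp: flip_def)
    with * show ?l by (intro exI[of _ "N + 1 - j"] exI[of _ "N - i"]) auto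
  qed
  then show ?thesis by (simp add: avoids_3_21_def avoids_12_3_def)
qed

lemma avoids_3_21_complement:
  assumes "\<pi> \<in> Sym N"
  shows "avoids_3_21 N (flip N \<circ> \<pi>) \<longleftrightarrow> avoids_1_23 N \<pi>"
proof -
  have flip: "flip N (\<pi> i) < flip N (\<pi> j) \<longleftrightarrow> \<pi> j < \<pi> i" if "i \<in> {1..N}" "j \<in> {1..N}" for i j
  proof -
    have "\<pi> i \<in> {1..N}" "\<pi> j \<in> {1..N}"
      using assms that permutes_in_image[of \<pi> "{1..N}"] by (auto simp: Sym_def)
    then show ?thesis by (auto simp: flip_def)
  qed
  show ?thesis
    unfolding avoids_1_23_def avoids_3_21_def comp_def
    by (intro arg_cong[of _ _ Not] ex_cong1 conj_cong refl flip) auto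
qed

lemma comp_flip_Sym [simp]: "\<pi> \<in> Sym N \<Longrightarrow> \<pi> \<circ> flip N \<in> Sym N" "\<pi> \<in> Sym N \<Longrightarrow> flip N \<circ> \<pi> \<in> Sym N"
  using permutes_compose flip_permutes by (auto simp only: Sym_def mem_Collect_eq)

lemma bij_betw_reverse:
  "bij_betw (\<lambda>\<pi>. \<pi> \<circ> flip N) (Sym_av N avoids_12_3) (Sym_av N avoids_3_21)"
proof (rule bij_betw_byWitness[where f' = "\<lambda>\<pi>. \<pi> \<circ> flip N"])
  have inv: "\<pi> \<circ> flip N \<circ> flip N = \<pi>" for \<pi> by (simp add: fun_eq_iff)
  then show "\<forall>\<pi>\<in>Sym_av N avoids_12_3. \<pi> \<circ> flip N \<circ> flip N = \<pi>"
    "\<forall>\<pi>\<in>Sym_av N avoids_3_21. \<pi> \<circ> flip N \<circ> flip N = \<pi>" by blast+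
  show "(\<lambda>\<pi>. \<pi> \<circ> flip N) ` Sym_av N avoids_12_3 \<subseteq> Sym_av N avoids_3_21"
    by (auto simp: Sym_av_def avoids_3_21_reverse)
  show "(\<lambda>\<pi>. \<pi> \<circ> flip N) ` Sym_av N avoids_3_21 \<subseteq> Sym_av N avoids_12_3"
    using avoids_3_21_reverse[of N "\<pi> \<circ> flip N" for \<pi>] by (auto simp: Sym_av_def inv)
qed

lemma bij_betw_complement:
  "bij_betw (\<lambda>\<pi>. flip N \<circ> \<pi>) (Sym_av N avoids_1_23) (Sym_av N avoids_3_21)"
proof (rule bij_betw_byWitness[where f' = "\<lambda>\<pi>. flip N \<circ> \<pi>"])
  have inv: "flip N \<circ> (flip N \<circ> \<pi>) = \<pi>" for \<pi> by (simp add: fun_eq_iff)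
  then show "\<forall>\<pi>\<in>Sym_av N avoids_1_23. flip N \<circ> (flip N \<circ> \<pi>) = \<pi>"
    "\<forall>\<pi>\<in>Sym_av N avoids_3_21. flip N \<circ> (flip N \<circ> \<pi>) = \<pi>" by blast+
  show "(\<lambda>\<pi>. flip N \<circ> \<pi>) ` Sym_av N avoids_1_23 \<subseteq> Sym_av N avoids_3_21"
    by (auto simp: Sym_av_def avoids_3_21_complement)
  show "(\<lambda>\<pi>. flip N \<circ> \<pi>) ` Sym_av N avoids_3_21 \<subseteq> Sym_av N avoids_1_23"
    using avoids_3_21_complement[of "flip N \<circ> \<pi>" N for \<pi>] by (auto simp: Sym_av_def inv)
qed

text \<open>A bijection under which the inversion numbers add up to a constant exchanges minimisers
  and maximisers. Nonemptiness ensures that \<open>Min\<close> is attained.\<close>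

lemma
  assumes g: "bij_betw g (Sym_av N av) (Sym_av N av')"
    and c: "\<And>\<pi>. \<pi> \<in> Sym_av N av \<Longrightarrow> inversions N (g \<pi>) + inversions N \<pi> = c"
    and ne: "Sym_av N av \<noteq> {}"
  shows maxinv_plus_mininv: "maxinv N av' + mininv N av = c"
    and card_Zset_eq_card_Yset: "card (Zset N av') = card (Yset N av)"
proof -
  have img: "Sym_av N av' = g ` Sym_av N av" using g by (simp add: bij_betw_def)
  have "mininv N av \<in> inversions N ` Sym_av N av"
    unfolding mininv_def using ne by (intro Min_in) (auto simp: finite_Sym_av)
  then obtain \<pi> where \<pi>: "\<pi> \<in> Sym_av N av" "mininv N av = inversions N \<pi>" by blast
  have le: "inversions N \<pi> \<le> inversions N \<tau>" if "\<tau> \<in> Sym_av N av" for \<tau>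
    unfolding \<pi>(2)[symmetric] mininv_def using that by (intro Min_le) (auto simp: finite_Sym_av)
  have "maxinv N av' = inversions N (g \<pi>)"
    unfolding maxinv_def
  proof (rule Max_eqI)
    fix k assume "k \<in> inversions N ` Sym_av N av'"
    then obtain \<tau> where "\<tau> \<in> Sym_av N av" "k = inversions N (g \<tau>)" using img by auto
    then show "k \<le> inversions N (g \<pi>)" using c[of \<tau>] c[OF \<pi>(1)] le[of \<tau>] by linarith
  qed (use \<pi> img in \<open>auto simp: finite_Sym_av\<close>)
  then show *: "maxinv N av' + mininv N av = c" using c \<pi> by simp
  have "inversions N (g \<tau>) = maxinv N av' \<longleftrightarrow> inversions N \<tau> = mininv N av"
    if "\<tau> \<in> Sym_av N av" for \<tau> using c[OF that] * by linarith
  then have "Zset N av' = g ` Yset N av" unfolding Zset_def Yset_def img by auto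
  moreover have "inj_on g (Yset N av)"
    using g by (auto simp: bij_betw_def Yset_def inj_on_def)
  ultimately show "card (Zset N av') = card (Yset N av)" by (simp add: card_image)
qed

text \<open>The identity has no descent, so it avoids 3-21; the two bijections supply preimages of
  it.\<close>

lemma Sym_av_nonempty: "Sym_av N avoids_12_3 \<noteq> {}" "Sym_av N avoids_1_23 \<noteq> {}"
proof -
  have "id \<in> Sym_av N avoids_3_21"
    by (auto simp: Sym_av_def Sym_def avoids_3_21_def permutes_id)
  then show "Sym_av N avoids_12_3 \<noteq> {}" "Sym_av N avoids_1_23 \<noteq> {}"
    using bij_betw_reverse[of N] bij_betw_complement[of N] by (auto simp: bij_betw_def)
qed

section \<open>Closed forms and the slope \<open>rho n\<close>\<close>

lemma ibinom_two: "0 \<le> a \<Longrightarrow> 2 * ibinom a 2 = a * (a - 1)"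
  using ibinom_nat[of "nat a" 2] int_choose_two[of "nat a"] by simp

lemma ibinom_three: "6 * ibinom (int d + 2) 3 = int d * (int d + 1) * (int d + 2)"
proof (induction d)
  case (Suc d)
  have "ibinom (int (Suc (d + 2))) 3 = ibinom (int d + 2) 3 + ibinom (int d + 2) 2"
    using ibinom_Suc[of "d + 2" 3] by (simp add: add.commute)
  then have "6 * ibinom (int (Suc d) + 2) 3 = 6 * ibinom (int d + 2) 3 + 3 * (2 * ibinom (int d + 2) 2)"
    by (simp add: algebra_simps)
  also have "\<dots> = int (Suc d) * (int (Suc d) + 1) * (int (Suc d) + 2)"
    unfolding Suc by (subst ibinom_two) (simp_all add: algebra_simps)
  finally show ?case .
qed (simp add: ibinom_def)

text \<open>The real number under the floor is the positive root of x (x + 3) = 2 (n + 1), so its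
  floor is the last \<open>d\<close> with \<open>shell d\<close> at most
  \<open>n + 1\<close>.\<close>

lemma rho_shell:
  obtains d where "rho n = int d" "shell d \<le> n + 1" "n + 1 < shell (Suc d)"
proof -
  define s where "s = sqrt (8 * real n + 17)"
  have s2: "s * s = 8 * real n + 17" by (simp add: s_def)
  have "4 \<le> s" unfolding s_def by (rule real_le_rsqrt) simp
  then have "0 \<le> rho n" unfolding rho_def s_def[symmetric] by simp
  then obtain d where d: "rho n = int d" using nonneg_int_cases by blast
  then have fl: "real d \<le> (- 3 + s) / 2" "(- 3 + s) / 2 < real d + 1"
    unfolding rho_def s_def[symmetric] by (simp_all add: floor_eq_iff)
  have "(2 * real d + 3) * (2 * real d + 3) \<le> s * s"
    using fl(1) by (intro mult_mono) auto
  then have "real (d * (d + 3)) \<le> real (2 * (n + 1))"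
    unfolding s2 by (simp add: algebra_simps)
  then have lo: "shell d \<le> n + 1" unfolding of_nat_le_iff shell_closed[symmetric] by simp
  have "s * s < (2 * real d + 5) * (2 * real d + 5)"
    using fl(2) \<open>4 \<le> s\<close> by (intro mult_strict_mono) auto
  then have "real (2 * (n + 1)) < real (Suc d * (Suc d + 3))"
    unfolding s2 by (simp add: algebra_simps)
  then have "n + 1 < shell (Suc d)" unfolding of_nat_less_iff shell_closed[symmetric] by simp
  with d lo show ?thesis using that by blast
qed

theorem corollary1p4:
  fixes n :: nat
  assumes "n \<ge> 1"
  shows "card (Zset (n + 1) avoids_3_21) = card (Yset (n + 1) avoids_1_23)
       \<and> card (Yset (n + 1) avoids_1_23) = card (Yset (n + 1) avoids_12_3)
       \<and> int (card (Yset (n + 1) avoids_12_3))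
           = ibinom (rho n) (lam n) + ibinom (rho n + 1) (lam n - 1)
       \<and> int (maxinv (n + 1) avoids_3_21)
           = ibinom (int n - rho n + 1) 2 + ibinom (rho n + 2) 3
       \<and> mininv (n + 1) avoids_1_23 = mininv (n + 1) avoids_12_3
       \<and> int (mininv (n + 1) avoids_12_3)
           = ibinom (int n + 1) 2 - ibinom (rho n + 2) 3 - ibinom (int n - rho n + 1) 2"
proof -
  obtain d where d: "rho n = int d" "shell d \<le> n + 1" "n + 1 < shell (Suc d)"
    by (rule rho_shell)
  have shell: "2 * int (shell d) = int d * (int d + 3)"
    using arg_cong[OF shell_closed[of d], of int] by simp
  have offset: "6 * int (offset d) = int d * (int d + 1) * (int d + 5)"
    using arg_cong[OF offset_closed[of d], of int] by (simp add: algebra_simps)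
  \<comment> \<open>This triangular number is \<open>shell d + 1\<close>, which makes
    \<open>lam n\<close> the excess of the word length \<open>n + 1\<close> over
    \<open>shell d\<close>.\<close>
  have "2 * tri (rho n + 1) = (int d + 2) * (int d + 1)"
    unfolding tri_def d by (subst ibinom_two) (simp_all add: algebra_simps)
  then have "2 * lam n = 2 * (int (n + 1) - int (shell d))"
    unfolding lam_def right_diff_distrib shell by (simp add: algebra_simps)
  then have lam: "lam n = int (n + 1) - int (shell d)" by simp
  have "d \<le> shell d" by (induction d) auto
  then have nd: "0 \<le> int n - int d + 1" using d(2) by simp
  note rev = bij_betw_reverse[of "n + 1"] inversions_reverse[of _ "n + 1"] Sym_av_nonempty(1)[of "n + 1"]
  note com = bij_betw_complement[of "n + 1"] inversions_complement[of _ "n + 1"] Sym_av_nonempty(2)[of "n + 1"]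
  have sub: "\<pi> \<in> Sym N" if "\<pi> \<in> Sym_av N av" for \<pi> N av using that by (simp add: Sym_av_def)
  \<comment> \<open>Reversal and complementation both lead to 3-21 with the same total, so the two
    minima agree.\<close>
  have sum12: "maxinv (n + 1) avoids_3_21 + mininv (n + 1) avoids_12_3 = (n + 1) choose 2"
    by (rule maxinv_plus_mininv[OF rev(1) rev(2)[OF sub] rev(3)])
  have sum23: "maxinv (n + 1) avoids_3_21 + mininv (n + 1) avoids_1_23 = (n + 1) choose 2"
    by (rule maxinv_plus_mininv[OF com(1) com(2)[OF sub] com(3)])
  have card12: "card (Zset (n + 1) avoids_3_21) = card (Yset (n + 1) avoids_12_3)"
    by (rule card_Zset_eq_card_Yset[OF rev(1) rev(2)[OF sub] rev(3)])
  have card23: "card (Zset (n + 1) avoids_3_21) = card (Yset (n + 1) avoids_1_23)"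
    by (rule card_Zset_eq_card_Yset[OF com(1) com(2)[OF sub] com(3)])
  \<comment> \<open>The factor 6 clears the denominators of \<open>offset\<close> and of the
    binomials, leaving a polynomial identity.\<close>
  have "6 * int (mininv (n + 1) avoids_12_3) = 6 * int d * (int n + 1) - 6 * int (offset d)"
    using mininv_12_3[OF d(2,3)] by (simp add: algebra_simps)
  also have "\<dots> = 3 * (2 * ibinom (int n + 1) 2) - 6 * ibinom (int d + 2) 3
      - 3 * (2 * ibinom (int n - int d + 1) 2)"
    using nd unfolding offset ibinom_three by (simp add: ibinom_two algebra_simps)
  finally have min: "int (mininv (n + 1) avoids_12_3)
      = ibinom (int n + 1) 2 - ibinom (rho n + 2) 3 - ibinom (int n - rho n + 1) 2"
    unfolding d by simp
  have "ibinom (int n + 1) 2 = int ((n + 1) choose 2)"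
    using ibinom_nat[of "n + 1" 2] by (simp add: add.commute)
  then have max: "int (maxinv (n + 1) avoids_3_21)
      = ibinom (int n - rho n + 1) 2 + ibinom (rho n + 2) 3"
    using min sum12 by linarith
  show ?thesis
    using card12 card23 card_Yset_12_3[OF d(2,3)] min max sum12 sum23
    unfolding lam d(1) by simp
qed

end
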